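(* Let $M\subset\mathbb{C}^9$ be the real submanifold of codimension $5$ through $0$ given, in the coordinates $(z,w)=(z_1,\dots,z_4,w_1,\dots,w_5)\in\mathbb{C}^9$, by the equations $\mathrm{Im}\,w_j=P_j(z,\bar z)$, $j=1,\dots,5$, where $$P_1=z_1\overline{z_2}+z_2\overline{z_1},\quad P_2=-i z_1\overline{z_2}+i z_2\overline{z_1},\quad P_3=z_3\overline{z_2}+z_4\overline{z_1}+z_2\overline{z_3}+z_1\overline{z_4},\quad P_4=z_1\overline{z_1},\quad P_5=z_2\overline{z_2}.$$ Define the holomorphic vector fields $$X=i\Big(z_1\frac{\partial}{\partial z_3}+z_2\frac{\partial}{\partial z_4}\Big),\quad Y=i\Big(-iz_1\frac{\partial}{\partial z_3}+iz_2\frac{\partial}{\partial z_4}\Big),\quad Z=i\,z_1\frac{\partial}{\partial z_4},\quad U=i\,z_2\frac{\partial}{\partial z_3},$$ and set $Y_0=-Y$, $Y_1=2Y$, $Z_1=-2Z$, $U_1=-2U$. Then the holomorphic vector field $$T=\tfrac12 w_1^2\,Y_0+\tfrac12 w_2^2\,Y+w_1w_2\,X+w_2w_5\,Z_1+w_2w_4\,U_1+w_4w_5\,Y_1$$ belongs to $\mathrm{hol}(M,0)$. Hence $2$-jet determination does not hold for germs of biholomorphisms sending $M$ to $M$: there exist two germs $F\neq G$ at $0$ of biholomorphic maps of $\mathbb{C}^9$, each sending $M$ to $M$, which have the same $2$-jet at $0$.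
   Context: $\mathrm{hol}(M,0)$ denotes the set of germs at $0$ of real-analytic infinitesimal CR automorphisms of $M$: germs at $0$ of holomorphic vector fields $V=\sum_{j} a_j(z,w)\frac{\partial}{\partial z_j}+\sum_k b_k(z,w)\frac{\partial}{\partial w_k}$ (with $a_j,b_k$ holomorphic near $0$) such that $\mathrm{Re}\,V=\frac12(V+\overline{V})$ is tangent to $M$ at the points of $M$ near $0$. A germ $F$ at $0$ of a biholomorphic map of $\mathbb{C}^9$ sends $M$ to $M$ if $F(M\cap\Omega)\subset M$ for some sufficiently small neighbourhood $\Omega$ of $0$. Two germs have the same $2$-jet at $0$ if all their partial derivatives of order at most $2$ (including order $0$) coincide at $0$. *)

theory Defs
  imports "HOL-Analysis.Analysis"
begin

(* Germs at a point p are handled through representatives: total functions that are only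
   constrained on some neighbourhood of p.  Every predicate below depends only on the germ,
   and equality of germs is \<open>\<forall>\<^sub>F x in nhds p. F x = G x\<close>. *)

subsection \<open>Holomorphic maps of several variables\<close>

text \<open>The operation \<open>*s\<close> is multiplication of a vector by a complex scalar, so the real derivative
  is required to be complex linear.\<close>

definition holomorphic_map_on :: "(complex^'n \<Rightarrow> complex^'m) \<Rightarrow> (complex^'n) set \<Rightarrow> bool"
  where "holomorphic_map_on F \<Omega> \<longleftrightarrow> open \<Omega> \<and>
    (\<forall>p\<in>\<Omega>. \<exists>D. (F has_derivative D) (at p) \<and> (\<forall>c v. D (c *s v) = c *s D v))"

definition biholomorphic_germ_at :: "complex^'n \<Rightarrow> (complex^'n \<Rightarrow> complex^'n) \<Rightarrow> bool"
  where "biholomorphic_germ_at p F \<longleftrightarrow>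
    (\<exists>\<Omega> F'. p \<in> \<Omega> \<and> holomorphic_map_on F \<Omega> \<and>
      holomorphic_map_on F' (F ` \<Omega>) \<and> (\<forall>x\<in>\<Omega>. F' (F x) = x))"

definition sends_germ_into :: "complex^'n \<Rightarrow> (complex^'n \<Rightarrow> complex^'n) \<Rightarrow> (complex^'n) set \<Rightarrow> bool"
  where "sends_germ_into p F M \<longleftrightarrow> (\<exists>\<Omega>. open \<Omega> \<and> p \<in> \<Omega> \<and> F ` (M \<inter> \<Omega>) \<subseteq> M)"

definition partial_deriv :: "'n::finite \<Rightarrow> (complex^'n \<Rightarrow> complex) \<Rightarrow> complex^'n \<Rightarrow> complex"
  where "partial_deriv j f p = deriv (\<lambda>t. f (p + t *s axis j 1)) 0"

text \<open>A list \<open>js\<close> of indices stands for an iterated partial derivative of order \<open>length js\<close>;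
  the empty list gives the value.  For holomorphic maps these determine all
  partial derivatives, those with respect to the conjugate variables being zero.\<close>

definition same_jet_at ::
  "complex^'n \<Rightarrow> nat \<Rightarrow> (complex^'n \<Rightarrow> complex^'m) \<Rightarrow> (complex^'n \<Rightarrow> complex^'m) \<Rightarrow> bool"
  where "same_jet_at p r F G \<longleftrightarrow>
    (\<forall>k. \<forall>js. length js \<le> r \<longrightarrow>
      foldr partial_deriv js (\<lambda>x. F x $ k) p = foldr partial_deriv js (\<lambda>x. G x $ k) p)"


subsection \<open>Infinitesimal CR automorphisms\<close>

definition tangent_space :: "'a::real_normed_vector set \<Rightarrow> 'a \<Rightarrow> 'a set"
  where "tangent_space M p =
    {v. \<exists>\<gamma> \<epsilon>. \<epsilon> > 0 \<and> \<gamma> C1_differentiable_on {-\<epsilon><..<\<epsilon>} \<and> \<gamma> ` {-\<epsilon><..<\<epsilon>} \<subseteq> M \<and>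
         \<gamma> 0 = p \<and> (\<gamma> has_vector_derivative v) (at (0::real))}"

text \<open>The holomorphic vector field \<open>\<Sum>j. a\<^sub>j \<partial>/\<partial>\<zeta>\<^sub>j\<close> is represented by its coefficient map
  \<open>V p $ j = a\<^sub>j p\<close>; thus \<open>\<partial>/\<partial>\<zeta>\<^sub>j\<close> is \<open>axis j 1\<close>.  Writing \<open>\<zeta>\<^sub>j = x\<^sub>j + \<i> y\<^sub>j\<close>,
  the real field \<open>Re V = (V + cnj V) / 2\<close> equals
  \<open>1/2 (\<Sum>j. Re a\<^sub>j \<partial>/\<partial>x\<^sub>j + Im a\<^sub>j \<partial>/\<partial>y\<^sub>j)\<close>, i.e. it is the real vector \<open>V p / 2\<close>
  of the underlying real vector space.\<close>

definition Re_field :: "(complex^'n \<Rightarrow> complex^'n) \<Rightarrow> complex^'n \<Rightarrow> complex^'n"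
  where "Re_field V p = (1/2) *\<^sub>R V p"

definition hol :: "(complex^'n) set \<Rightarrow> complex^'n \<Rightarrow> (complex^'n \<Rightarrow> complex^'n) set"
  where "hol M p = {V. \<exists>\<Omega>. p \<in> \<Omega> \<and> holomorphic_map_on V \<Omega> \<and>
    (\<forall>q \<in> M \<inter> \<Omega>. Re_field V q \<in> tangent_space M q)}"


subsection \<open>The submanifold and the vector fields\<close>

text \<open>The coordinates are \<open>(z\<^sub>1, \<dots>, z\<^sub>4, w\<^sub>1, \<dots>, w\<^sub>5)\<close>.  In the index type \<open>9\<close> arithmetic is
  modulo nine, so that the last index \<open>4 + 5\<close> is \<open>0\<close>; the nine indices are distinct.\<close>

abbreviation zc :: "9 \<Rightarrow> complex^9 \<Rightarrow> complex" where "zc j p \<equiv> p $ j"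
abbreviation wc :: "9 \<Rightarrow> complex^9 \<Rightarrow> complex" where "wc k p \<equiv> p $ (4 + k)"

abbreviation d_dz :: "9 \<Rightarrow> complex^9" where "d_dz j \<equiv> axis j 1"

definition P1 :: "complex^9 \<Rightarrow> complex"
  where "P1 p = zc 1 p * cnj (zc 2 p) + zc 2 p * cnj (zc 1 p)"
definition P2 :: "complex^9 \<Rightarrow> complex"
  where "P2 p = - \<i> * zc 1 p * cnj (zc 2 p) + \<i> * zc 2 p * cnj (zc 1 p)"
definition P3 :: "complex^9 \<Rightarrow> complex"
  where "P3 p = zc 3 p * cnj (zc 2 p) + zc 4 p * cnj (zc 1 p)
              + zc 2 p * cnj (zc 3 p) + zc 1 p * cnj (zc 4 p)"
definition P4 :: "complex^9 \<Rightarrow> complex"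
  where "P4 p = zc 1 p * cnj (zc 1 p)"
definition P5 :: "complex^9 \<Rightarrow> complex"
  where "P5 p = zc 2 p * cnj (zc 2 p)"

definition M :: "(complex^9) set"
  where "M = {p. complex_of_real (Im (wc 1 p)) = P1 p \<and>
                 complex_of_real (Im (wc 2 p)) = P2 p \<and>
                 complex_of_real (Im (wc 3 p)) = P3 p \<and>
                 complex_of_real (Im (wc 4 p)) = P4 p \<and>
                 complex_of_real (Im (wc 5 p)) = P5 p}"

definition X_field :: "complex^9 \<Rightarrow> complex^9"
  where "X_field p = \<i> *s (zc 1 p *s d_dz 3 + zc 2 p *s d_dz 4)"
definition Y_field :: "complex^9 \<Rightarrow> complex^9"
  where "Y_field p = \<i> *s ((- \<i> * zc 1 p) *s d_dz 3 + (\<i> * zc 2 p) *s d_dz 4)"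
definition Z_field :: "complex^9 \<Rightarrow> complex^9"
  where "Z_field p = (\<i> * zc 1 p) *s d_dz 4"
definition U_field :: "complex^9 \<Rightarrow> complex^9"
  where "U_field p = (\<i> * zc 2 p) *s d_dz 3"

definition Y0_field :: "complex^9 \<Rightarrow> complex^9"
  where "Y0_field p = - Y_field p"
definition Y1_field :: "complex^9 \<Rightarrow> complex^9"
  where "Y1_field p = 2 *s Y_field p"
definition Z1_field :: "complex^9 \<Rightarrow> complex^9"
  where "Z1_field p = (- 2) *s Z_field p"
definition U1_field :: "complex^9 \<Rightarrow> complex^9"
  where "U1_field p = (- 2) *s U_field p"

definition T_field :: "complex^9 \<Rightarrow> complex^9"
  where "T_field p =
      (1/2 * (wc 1 p)\<^sup>2) *s Y0_field p
    + (1/2 * (wc 2 p)\<^sup>2) *s Y_field p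
    + (wc 1 p * wc 2 p) *s X_field p
    + (wc 2 p * wc 5 p) *s Z1_field p
    + (wc 2 p * wc 4 p) *s U1_field p
    + (wc 4 p * wc 5 p) *s Y1_field p"

end

theory Submission
  imports Defs
begin

text \<open>The field \<open>T\<close> only has components along \<open>z\<^sub>3, z\<^sub>4\<close>, and these depend neither on \<open>z\<^sub>3\<close> nor
  on \<open>z\<^sub>4\<close>. Hence the flow of \<open>T\<close> is \<open>p \<mapsto> p + s T p\<close>, globally defined and polynomial. Along it only
  \<open>P\<^sub>3\<close> can change, by \<open>2 s Re (T\<^sub>3 cnj z\<^sub>2 + T\<^sub>4 cnj z\<^sub>1)\<close>, which vanishes on \<open>M\<close> because
  \<open>P\<^sub>1\<^sup>2 + P\<^sub>2\<^sup>2 = 4 P\<^sub>4 P\<^sub>5\<close>. Since \<open>T\<close> is homogeneous of degree three, the time-one map and the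
  identity have the same 2-jet.\<close>

subsection \<open>Complex differentiability\<close>

definition complex_differentiable_at :: "(complex^'n \<Rightarrow> complex^'m) \<Rightarrow> complex^'n \<Rightarrow> bool"
  where "complex_differentiable_at F p \<longleftrightarrow>
    (\<exists>D. (F has_derivative D) (at p) \<and> (\<forall>c v. D (c *s v) = c *s D v))"

text \<open>Products of coefficients live in \<open>complex\<close>, which is not of the form
  \<open>complex^'m\<close>, so scalar functions get their own version.\<close>

definition scalar_differentiable_at :: "(complex^'n \<Rightarrow> complex) \<Rightarrow> complex^'n \<Rightarrow> bool"
  where "scalar_differentiable_at f p \<longleftrightarrow>
    (\<exists>D. (f has_derivative D) (at p) \<and> (\<forall>c v. D (c *s v) = c * D v))"

lemma holomorphic_map_on_iff:
  "holomorphic_map_on F \<Omega> \<longleftrightarrow> open \<Omega> \<and> (\<forall>p\<in>\<Omega>. complex_differentiable_at F p)"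
  by (simp add: holomorphic_map_on_def complex_differentiable_at_def)

lemma scalar_differentiable_const: "scalar_differentiable_at (\<lambda>x. c) p"
  unfolding scalar_differentiable_at_def by (rule exI[of _ "\<lambda>_. 0"]) simp

lemma scalar_differentiable_nth: "scalar_differentiable_at (\<lambda>x. x $ i) p"
  unfolding scalar_differentiable_at_def
  by (rule exI[of _ "\<lambda>v. v $ i"])
    (simp add: bounded_linear.has_derivative[OF bounded_linear_vec_nth])

lemma scalar_differentiable_add:
  assumes "scalar_differentiable_at f p" "scalar_differentiable_at g p"
  shows "scalar_differentiable_at (\<lambda>x. f x + g x) p"
proof -
  obtain D E where "(f has_derivative D) (at p)" "\<And>c v. D (c *s v) = c * D v"
    and "(g has_derivative E) (at p)" "\<And>c v. E (c *s v) = c * E v"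
    using assms unfolding scalar_differentiable_at_def by blast
  then show ?thesis unfolding scalar_differentiable_at_def
    by (intro exI[of _ "\<lambda>v. D v + E v"]) (auto intro: has_derivative_add simp: algebra_simps)
qed

lemma scalar_differentiable_mult:
  assumes "scalar_differentiable_at f p" "scalar_differentiable_at g p"
  shows "scalar_differentiable_at (\<lambda>x. f x * g x) p"
proof -
  obtain D E where "(f has_derivative D) (at p)" "\<And>c v. D (c *s v) = c * D v"
    and "(g has_derivative E) (at p)" "\<And>c v. E (c *s v) = c * E v"
    using assms unfolding scalar_differentiable_at_def by blast
  then show ?thesis unfolding scalar_differentiable_at_def
    by (intro exI[of _ "\<lambda>v. f p * E v + D v * g p"] conjI has_derivative_mult)
      (auto simp: algebra_simps)
qed

lemma complex_differentiable_ident: "complex_differentiable_at (\<lambda>x. x) p"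
  unfolding complex_differentiable_at_def by (rule exI[of _ "\<lambda>v. v"]) simp

lemma complex_differentiable_add:
  assumes "complex_differentiable_at F p" "complex_differentiable_at G p"
  shows "complex_differentiable_at (\<lambda>x. F x + G x) p"
proof -
  obtain D E where "(F has_derivative D) (at p)" "\<And>c v. D (c *s v) = c *s D v"
    and "(G has_derivative E) (at p)" "\<And>c v. E (c *s v) = c *s E v"
    using assms unfolding complex_differentiable_at_def by blast
  then show ?thesis unfolding complex_differentiable_at_def
    by (intro exI[of _ "\<lambda>v. D v + E v"])
      (auto intro: has_derivative_add simp: vector_add_ldistrib)
qed

lemma bounded_linear_vector_mult_left: "bounded_linear (\<lambda>c::complex. c *s (v::complex^'m))"
  by (rule linear_conv_bounded_linear[THEN iffD1], rule linearI)
    (simp_all add: vec_eq_iff algebra_simps)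

lemma complex_differentiable_scale:
  assumes "scalar_differentiable_at f p"
  shows "complex_differentiable_at (\<lambda>x. f x *s v) p"
proof -
  obtain D where "(f has_derivative D) (at p)" "\<And>c v. D (c *s v) = c * D v"
    using assms unfolding scalar_differentiable_at_def by blast
  then show ?thesis unfolding complex_differentiable_at_def
    by (intro exI[of _ "\<lambda>u. D u *s v"])
      (auto intro: bounded_linear.has_derivative[OF bounded_linear_vector_mult_left]
        simp: vector_smult_assoc)
qed

subsection \<open>Polynomial functions vanishing to a given order at the origin\<close>

text \<open>Polynomials with \<open>n\<close> as a lower bound for the order of vanishing at 0.
  Generating them inductively lets a single induction produce partial derivatives together with
  their orders.\<close>

inductive vanishing :: "nat \<Rightarrow> (complex^'n \<Rightarrow> complex) \<Rightarrow> bool"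
  where
    zero: "vanishing n (\<lambda>x. 0)"
  | const: "vanishing 0 (\<lambda>x. c)"
  | nth: "vanishing (Suc 0) (\<lambda>x. x $ i)"
  | add: "vanishing n f \<Longrightarrow> vanishing n g \<Longrightarrow> vanishing n (\<lambda>x. f x + g x)"
  | mult: "vanishing m f \<Longrightarrow> vanishing n g \<Longrightarrow> vanishing (m + n) (\<lambda>x. f x * g x)"
  | mono: "vanishing n f \<Longrightarrow> m \<le> n \<Longrightarrow> vanishing m f"

lemma vanishing_cubic: "vanishing 3 (\<lambda>x. c * x $ i * x $ j * x $ k)"
  using vanishing.mult[OF vanishing.mult[OF vanishing.mult[OF vanishing.const vanishing.nth]
    vanishing.nth] vanishing.nth, of c i j k]
  by (simp add: numeral_3_eq_3)

lemma vanishing_at_0: "vanishing n f \<Longrightarrow> n > 0 \<Longrightarrow> f 0 = 0"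
  by (induction rule: vanishing.induct) auto

text \<open>\<open>partial_deriv\<close> rests on \<open>deriv\<close>, which is informative only
  where a derivative exists; existence and the drop of the order are therefore proved together. In
  the product rule only one factor per summand loses an order.\<close>

lemma vanishing_DERIV:
  assumes "vanishing n f"
  shows "\<exists>g. vanishing (n - 1) g \<and> (\<forall>p.
    ((\<lambda>t. f (p + t *s axis j 1)) has_field_derivative g p) (at 0))"
  using assms
proof (induction rule: vanishing.induct)
  case (zero n)
  show ?case by (rule exI[of _ "\<lambda>_. 0"]) (simp add: vanishing.zero)
next
  case (const c)
  show ?case by (rule exI[of _ "\<lambda>_. 0"]) (simp add: vanishing.zero)
next
  case (nth i)
  show ?case
    by (rule exI[of _ "\<lambda>_. axis j 1 $ i"])
      (auto intro!: derivative_eq_intros vanishing.const)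
next
  case (add n f g)
  then obtain f' g' where "vanishing (n - 1) f'" "vanishing (n - 1) g'"
    "\<And>p. ((\<lambda>t. f (p + t *s axis j 1)) has_field_derivative f' p) (at 0)"
    "\<And>p. ((\<lambda>t. g (p + t *s axis j 1)) has_field_derivative g' p) (at 0)"
    by blast
  then show ?case
    by (intro exI[of _ "\<lambda>p. f' p + g' p"] conjI allI vanishing.add DERIV_add)
next
  case (mult m f n g)
  obtain f' where f': "vanishing (m - 1) f'"
    "\<And>p. ((\<lambda>t. f (p + t *s axis j 1)) has_field_derivative f' p) (at 0)"
    using mult.IH by blast
  obtain g' where g': "vanishing (n - 1) g'"
    "\<And>p. ((\<lambda>t. g (p + t *s axis j 1)) has_field_derivative g' p) (at 0)"
    using mult.IH by blast
  \<comment> \<open>Subtraction is truncated: for \<open>m = 0\<close> the bound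
    \<open>(m - 1) + n\<close> can exceed \<open>m + n - 1\<close>, hence the weakening by
    \<open>mono\<close>.\<close>
  have "vanishing (m + n - 1) (\<lambda>p. f' p * g p)"
    using vanishing.mult[OF f'(1) mult.hyps(2)] by (rule vanishing.mono) simp
  moreover have "vanishing (m + n - 1) (\<lambda>p. g' p * f p)"
    using vanishing.mult[OF g'(1) mult.hyps(1)] by (rule vanishing.mono) simp
  moreover have "((\<lambda>t. f (p + t *s axis j 1) * g (p + t *s axis j 1))
      has_field_derivative f' p * g p + g' p * f p) (at 0)" for p
    using DERIV_mult[OF f'(2) g'(2), of p p] by simp
  ultimately show ?case
    by (intro exI[of _ "\<lambda>p. f' p * g p + g' p * f p"] conjI allI vanishing.add)
next
  case (mono n f m)
  then show ?case by (meson diff_le_mono vanishing.mono)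
qed

lemma vanishing_partial_deriv:
  assumes "vanishing n f"
  shows "vanishing (n - 1) (partial_deriv j f)"
    and "((\<lambda>t. f (p + t *s axis j 1)) has_field_derivative partial_deriv j f p) (at 0)"
proof -
  obtain g where g: "vanishing (n - 1) g"
    "\<And>p. ((\<lambda>t. f (p + t *s axis j 1)) has_field_derivative g p) (at 0)"
    using vanishing_DERIV[OF assms] by blast
  have "partial_deriv j f = g"
    by (auto simp: partial_deriv_def fun_eq_iff intro: DERIV_imp_deriv g)
  with g show "vanishing (n - 1) (partial_deriv j f)"
    and "((\<lambda>t. f (p + t *s axis j 1)) has_field_derivative partial_deriv j f p) (at 0)"
    by auto
qed

lemma vanishing_foldr_partial_deriv:
  "vanishing n f \<Longrightarrow> vanishing (n - length js) (foldr partial_deriv js f)"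
proof (induction js)
  case (Cons j js)
  then show ?case
    using vanishing_partial_deriv(1)[OF Cons.IH, of j] by simp
qed simp

text \<open>Additivity of \<open>deriv\<close> relies on differentiability, which
  \<open>vanishing\<close> guarantees at each stage because it is preserved by
  \<open>partial_deriv\<close>.\<close>

lemma foldr_partial_deriv_add:
  assumes "vanishing m f" "vanishing n g"
  shows "foldr partial_deriv js (\<lambda>x. f x + g x)
    = (\<lambda>x. foldr partial_deriv js f x + foldr partial_deriv js g x)"
proof (induction js)
  case (Cons j js)
  have "partial_deriv j (\<lambda>x. foldr partial_deriv js f x + foldr partial_deriv js g x) p
    = partial_deriv j (foldr partial_deriv js f) p + partial_deriv j (foldr partial_deriv js g) p"
    for p
    using DERIV_imp_deriv[OF DERIV_add[OF
        vanishing_partial_deriv(2)[OF vanishing_foldr_partial_deriv[OF assms(1)]]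
        vanishing_partial_deriv(2)[OF vanishing_foldr_partial_deriv[OF assms(2)]]]]
    unfolding partial_deriv_def .
  then show ?case unfolding foldr_Cons comp_apply Cons.IH by blast
qed simp

text \<open>At most \<open>r\<close> derivatives leave \<open>G\<close> with order at least one,
  hence value 0 at the origin. For \<open>F\<close> the order \<open>m\<close> is arbitrary: being
  polynomial is what matters.\<close>

lemma same_jet_at_add_vanishing:
  fixes F G :: "complex^'n \<Rightarrow> complex^'m"
  assumes "\<And>k. vanishing m (\<lambda>x. F x $ k)" "\<And>k. vanishing (Suc r) (\<lambda>x. G x $ k)"
  shows "same_jet_at 0 r (\<lambda>x. F x + G x) F"
  unfolding same_jet_at_def
proof (intro allI impI)
  fix k and js :: "'n list"
  assume "length js \<le> r"
  then have "foldr partial_deriv js (\<lambda>x. G x $ k) 0 = 0"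
    by (intro vanishing_at_0[OF vanishing_foldr_partial_deriv[OF assms(2)]]) simp
  then show "foldr partial_deriv js (\<lambda>x. (F x + G x) $ k) 0
    = foldr partial_deriv js (\<lambda>x. F x $ k) 0"
    by (simp add: foldr_partial_deriv_add[OF assms])
qed

lemma vanishing_imp_differentiable: "vanishing n f \<Longrightarrow> scalar_differentiable_at f p"
  by (induction rule: vanishing.induct)
    (blast intro: scalar_differentiable_const scalar_differentiable_nth
      scalar_differentiable_add scalar_differentiable_mult)+

subsection \<open>The flow of the field\<close>

text \<open>The coefficient of \<open>T_field\<close> along \<open>z3\<close>, with squares written
  out and signs moved into the constants so that each summand matches
  \<open>vanishing_cubic\<close>.\<close>

definition T3 :: "complex^9 \<Rightarrow> complex"
  where "T3 p = 1/2 * wc 2 p * wc 2 p * zc 1 p + (-1/2) * wc 1 p * wc 1 p * zc 1 p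
    + \<i> * wc 1 p * wc 2 p * zc 1 p + 2 * wc 4 p * wc 5 p * zc 1 p
    + (-2 * \<i>) * wc 2 p * wc 4 p * zc 2 p"

definition T4 :: "complex^9 \<Rightarrow> complex"
  where "T4 p = 1/2 * wc 1 p * wc 1 p * zc 2 p + (-1/2) * wc 2 p * wc 2 p * zc 2 p
    + \<i> * wc 1 p * wc 2 p * zc 2 p + (-2) * wc 4 p * wc 5 p * zc 2 p
    + (-2 * \<i>) * wc 2 p * wc 5 p * zc 1 p"

lemma T_field_eq: "T_field p = T3 p *s axis 3 1 + T4 p *s axis 4 1"
  unfolding T_field_def Y0_field_def Y_field_def X_field_def Z1_field_def Z_field_def
    U1_field_def U_field_def Y1_field_def T3_def T4_def
  by (simp add: vec_eq_iff axis_def power2_eq_square algebra_simps)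

lemma T_field_nth: "T_field p $ k = (if k = 3 then T3 p else if k = 4 then T4 p else 0)"
  by (simp add: T_field_eq axis_def)

text \<open>\<open>T3\<close> and \<open>T4\<close> involve only \<open>z1\<close>,
  \<open>z2\<close> and the \<open>w\<close> coordinates, which a displacement along
  \<open>T_field\<close> leaves fixed.\<close>

lemma T_field_flow: "T_field (p + c *s T_field p) = T_field p"
  by (simp add: T_field_eq[of "p + _"] T_field_eq[of p] T3_def T4_def T_field_nth axis_def)

text \<open>Once Im w_k = P_k is substituted, all terms cancel except -Re w_2 (P1^2 + P2^2 - 4 P4
  P5), and z1 cnj z2 has real part P1/2 and imaginary part P2/2.\<close>

lemma T_field_annihilates_P3:
  assumes "p \<in> M"
  shows "Re (T3 p * cnj (zc 2 p) + T4 p * cnj (zc 1 p)) = 0"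
proof -
  \<comment> \<open>In real coordinates the claim becomes a polynomial identity, left to
    normalisation.\<close>
  define a b c d where "a = Re (zc 1 p)" "b = Im (zc 1 p)" "c = Re (zc 2 p)" "d = Im (zc 2 p)"
  have im: "Im (wc 1 p) = 2 * (a * c + b * d)" "Im (wc 2 p) = 2 * (b * c - a * d)"
    "Im (wc 4 p) = a\<^sup>2 + b\<^sup>2" "Im (wc 5 p) = c\<^sup>2 + d\<^sup>2"
    using assms
    by (simp_all add: M_def P1_def P2_def P4_def P5_def complex_eq_iff a_b_c_d_def
        power2_eq_square algebra_simps)
  show ?thesis
    by (simp add: T3_def T4_def im[simplified] a_b_c_d_def[symmetric] power2_eq_square field_simps)
qed

lemma flow_in_M:
  assumes "p \<in> M"
  shows "p + complex_of_real s *s T_field p \<in> M"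
proof -
  \<comment> \<open>This is the exact increment of \<open>P3\<close>, which is real affine in
    \<open>z3\<close> and \<open>z4\<close>; since \<open>s\<close> is real, it factors out of the
    conjugate half too.\<close>
  have "complex_of_real s * (T3 p * cnj (zc 2 p) + T4 p * cnj (zc 1 p)
      + cnj (T3 p * cnj (zc 2 p) + T4 p * cnj (zc 1 p))) = 0"
    using T_field_annihilates_P3[OF assms] by (simp add: complex_eq_iff)
  then have "P3 (p + complex_of_real s *s T_field p) = P3 p"
    by (simp add: P3_def T_field_nth algebra_simps)
  with assms show ?thesis
    by (simp add: M_def P1_def P2_def P4_def P5_def T_field_nth)
qed

lemma vanishing_T3: "vanishing 3 T3" and vanishing_T4: "vanishing 3 T4"
  unfolding T3_def[abs_def] T4_def[abs_def]
  by (intro vanishing.add vanishing_cubic)+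

lemma complex_differentiable_T_field: "complex_differentiable_at T_field p"
  unfolding T_field_eq[abs_def]
  by (intro complex_differentiable_add complex_differentiable_scale
      vanishing_imp_differentiable[OF vanishing_T3] vanishing_imp_differentiable[OF vanishing_T4])

lemma holomorphic_T_field: "holomorphic_map_on T_field UNIV"
  by (simp add: holomorphic_map_on_iff complex_differentiable_T_field)

lemma holomorphic_flow: "holomorphic_map_on (\<lambda>p. p + c *s T_field p) UNIV"
proof -
  have "complex_differentiable_at (\<lambda>p. c *s T_field p) p" for p
  proof -
    obtain D where "(T_field has_derivative D) (at p)" "\<And>c v. D (c *s v) = c *s D v"
      using complex_differentiable_T_field unfolding complex_differentiable_at_def by blast
    moreover have "bounded_linear (\<lambda>v::complex^9. c *s v)"
      by (rule linear_conv_bounded_linear[THEN iffD1], rule linearI)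
        (simp_all add: vec_eq_iff algebra_simps)
    ultimately show ?thesis unfolding complex_differentiable_at_def
      by (intro exI[of _ "\<lambda>u. c *s D u"])
        (auto intro: bounded_linear.has_derivative simp: vector_smult_assoc mult.commute)
  qed
  then show ?thesis
    by (simp add: holomorphic_map_on_iff complex_differentiable_add complex_differentiable_ident)
qed

lemma biholomorphic_flow: "biholomorphic_germ_at 0 (\<lambda>p. p + c *s T_field p)"
proof -
  have inv: "(p + c *s T_field p) + (- c) *s T_field (p + c *s T_field p) = p" for c p
    by (simp add: T_field_flow)
  \<comment> \<open>Surjectivity makes the image \<open>UNIV\<close>, on which the inverse, the flow
    at time \<open>- c\<close>, is holomorphic.\<close>
  have "surj (\<lambda>p. p + c *s T_field p)"
    using inv[of _ "- c"] by (intro surjI[of _ "\<lambda>p. p + (- c) *s T_field p"]) simp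
  then show ?thesis
    unfolding biholomorphic_germ_at_def using inv[of _ c] holomorphic_flow[of c] holomorphic_flow[of "- c"]
    by (intro exI[of _ UNIV] exI[of _ "\<lambda>p. p + (- c) *s T_field p"] conjI ballI) simp_all
qed

lemma sends_germ_into_flow: "sends_germ_into p (\<lambda>p. p + complex_of_real s *s T_field p) M"
  unfolding sends_germ_into_def by (rule exI[of _ UNIV]) (auto intro: flow_in_M)

lemma T_field_in_hol: "T_field \<in> hol M 0"
proof -
  have "Re_field T_field q \<in> tangent_space M q" if "q \<in> M" for q
  proof -
    define \<gamma> where "\<gamma> = (\<lambda>t::real. q + t *\<^sub>R Re_field T_field q)"
    \<comment> \<open>The integral curve of the real field is a straight line; the factor 1/2 in
      \<open>Re_field\<close> halves the flow time.\<close>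
    have eq: "\<gamma> t = q + complex_of_real (t / 2) *s T_field q" for t
      by (simp add: \<gamma>_def Re_field_def vec_eq_iff complex_eq_iff)
    have "\<gamma> t \<in> M" for t
      unfolding eq by (rule flow_in_M[OF that])
    moreover have "(\<gamma> has_vector_derivative Re_field T_field q) (at t)" for t
      unfolding \<gamma>_def by (auto intro!: derivative_eq_intros)
    moreover from this have "\<gamma> C1_differentiable_on {-1<..<1}"
      unfolding C1_differentiable_on_def by (intro exI[of _ "\<lambda>_. Re_field T_field q"]) simp
    ultimately show ?thesis
      unfolding tangent_space_def
      by (intro CollectI exI[of _ \<gamma>] exI[of _ 1]) (auto simp: \<gamma>_def)
  qed
  then show ?thesis
    unfolding hol_def using holomorphic_T_field by blast
qed

subsection \<open>The 2-jet of the flow\<close>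

lemma not_eventually_fixed: "\<not> (\<forall>\<^sub>F p in nhds 0. p + T_field p = p)"
proof
  assume "\<forall>\<^sub>F p in nhds 0. p + T_field p = p"
  then have ev: "\<forall>\<^sub>F p in nhds 0. T_field p = 0" by simp
  \<comment> \<open>Here z1 = w4 = w5 = 1 and w1 = w2 = 0, so only the term 2 w4 w5 z1 survives and
    \<open>T3 (t *\<^sub>R v)\<close> is 2 t^3.\<close>
  define v :: "complex^9" where "v = axis 1 1 + axis (4 + 4) 1 + axis (4 + 5) 1"
  have "((\<lambda>t. t *\<^sub>R v) \<longlongrightarrow> 0 *\<^sub>R v) (at (0::real))"
    by (intro tendsto_intros)
  then have "\<forall>\<^sub>F t in at (0::real). T_field (t *\<^sub>R v) = 0 \<and> t \<noteq> 0"
    using ev by (auto simp: filterlim_iff eventually_conj_iff eventually_at_filter)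
  then obtain t :: real where "T_field (t *\<^sub>R v) $ 3 = 0" "t \<noteq> 0"
    using eventually_happens by force
  then show False
    by (simp add: T_field_nth T3_def v_def axis_def)
qed

lemma same_jet_flow: "same_jet_at 0 2 (\<lambda>p. p + T_field p) (\<lambda>p. p)"
proof (rule same_jet_at_add_vanishing)
  show "vanishing (Suc 0) (\<lambda>p. p $ k)" for k :: 9
    by (rule vanishing.nth)
  show "vanishing (Suc 2) (\<lambda>p. T_field p $ k)" for k
    using vanishing_T3 vanishing_T4
    by (cases "k = 3"; cases "k = 4") (simp_all add: T_field_nth vanishing.zero)
qed

theorem theorem7:
  shows "T_field \<in> hol M 0 \<and>
    (\<exists>F G :: complex^9 \<Rightarrow> complex^9.
       biholomorphic_germ_at 0 F \<and> biholomorphic_germ_at 0 G \<and>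
       sends_germ_into 0 F M \<and> sends_germ_into 0 G M \<and>
       \<not> (\<forall>\<^sub>F p in nhds 0. F p = G p) \<and>
       same_jet_at 0 2 F G)"
  \<comment> \<open>The two germs are the flow at times 1 and 0, the latter being the
    identity.\<close>
  using T_field_in_hol biholomorphic_flow[of 1] biholomorphic_flow[of 0]
    sends_germ_into_flow[of 0 1] sends_germ_into_flow[of 0 0]
    not_eventually_fixed same_jet_flow
  by (intro conjI exI[of _ "\<lambda>p. p + T_field p"] exI[of _ "\<lambda>p. p"]) simp_all

end
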